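(* Let $\lambda$ be a positive integer, and let $(d,b)$ be an optimal solution of the scaled problem $\mathrm{DR}(\lambda)$. Then there exists an optimal solution $(d^*,b^* )$ of the dock re-allocation problem $\mathrm{DR}$ such that $$\|(d^*+b^* )-(d+b)\|_1\le 10\,n\,\lambda .$$
   Context: Let $n\ge 1$ and $N=\{1,\dots,n\}$. For $y\in\mathbb{R}^n$ and $X\subseteq N$ write $y(X)=\sum_{i\in X}y(i)$. Given are vectors $\bar d,\bar b\in\mathbb{Z}^n_+$ with $D=\bar d(N)$, $B=\bar b(N)$, a positive integer $\gamma$, integer vectors $\ell,u\in\mathbb{Z}^n$, and for each $i\in N$ a multimodular function $c_i:\mathbb{Z}^2_+\to\mathbb{R}$, meaning that for integers $\alpha,\beta$: (1) $c_i(\alpha+1,\beta+1)-c_i(\alpha+1,\beta)\ge c_i(\alpha,\beta+1)-c_i(\alpha,\beta)$ for $\alpha,\beta\ge 0$; (2) $c_i(\alpha-1,\beta+1)-c_i(\alpha-1,\beta)\ge c_i(\alpha,\beta)-c_i(\alpha,\beta-1)$ for $\alpha,\beta\ge 1$; (3) $c_i(\alpha+1,\beta-1)-c_i(\alpha,\beta-1)\ge c_i(\alpha,\beta)-c_i(\alpha-1,\beta)$ for $\alpha,\beta\ge1$. Problem $\mathrm{DR}$: minimize $c(d,b)=\sum_{i=1}^n c_i(d(i),b(i))$ over $d,b\in\mathbb{Z}^n_+$ subject to $d(N)+b(N)=D+B$, $b(N)\le B$, $\|(d+b)-(\bar d+\bar b)\|_1\le 2\gamma$, and $\ell\le d+b\le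 u$ (componentwise). Scaled problem $\mathrm{DR}(\lambda)$, for a positive integer $\lambda$: fix an arbitrarily chosen feasible solution $(\widetilde d,\widetilde b)$ of $\mathrm{DR}$; $\mathrm{DR}(\lambda)$ is obtained from $\mathrm{DR}$ by adding the constraints $d(i)\equiv\widetilde d(i) \pmod\lambda$ and $b(i)\equiv\widetilde b(i)\pmod\lambda$ for all $i\in N$. (If there is a feasible solution all of whose components are multiples of $\lambda$ and it is taken as $(\widetilde d,\widetilde b)$, this says that all $d(i)$, $b(i)$ are integer multiples of $\lambda$.) *)

theory Defs
  imports "HOL-Analysis.Analysis" "HOL-Number_Theory.Cong"
begin

text \<open>
  The index set \<open>N = {1, \<dots>, n}\<close> is rendered by an arbitrary type \<open>'n\<close> of class \<open>finite\<close>,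
  so that \<open>n = CARD('n) \<ge> 1\<close>, and integer vectors have type \<open>int ^ 'n\<close>, on which \<open>\<le>\<close> is the
  componentwise order.
\<close>

definition vec_sum :: "int ^ 'n \<Rightarrow> int" where
  "vec_sum y = (\<Sum>i\<in>UNIV. y $ i)"

definition l1_norm :: "int ^ 'n \<Rightarrow> int" where
  "l1_norm y = (\<Sum>i\<in>UNIV. \<bar>y $ i\<bar>)"

text \<open>
  A function on the nonnegative quadrant of the integer lattice is represented by a total function
  on pairs of integers. The guards ensure that only values at nonnegative arguments are constrained.
\<close>

definition multimodular :: "(int \<Rightarrow> int \<Rightarrow> real) \<Rightarrow> bool" where
  "multimodular f \<longleftrightarrow>
     (\<forall>\<alpha> \<beta>. \<alpha> \<ge> 0 \<and> \<beta> \<ge> 0 \<longrightarrow>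
        f (\<alpha> + 1) (\<beta> + 1) - f (\<alpha> + 1) \<beta> \<ge> f \<alpha> (\<beta> + 1) - f \<alpha> \<beta>) \<and>
     (\<forall>\<alpha> \<beta>. \<alpha> \<ge> 1 \<and> \<beta> \<ge> 1 \<longrightarrow>
        f (\<alpha> - 1) (\<beta> + 1) - f (\<alpha> - 1) \<beta> \<ge> f \<alpha> \<beta> - f \<alpha> (\<beta> - 1)) \<and>
     (\<forall>\<alpha> \<beta>. \<alpha> \<ge> 1 \<and> \<beta> \<ge> 1 \<longrightarrow>
        f (\<alpha> + 1) (\<beta> - 1) - f \<alpha> (\<beta> - 1) \<ge> f \<alpha> \<beta> - f (\<alpha> - 1) \<beta>)"

definition DR_cost ::
  "('n \<Rightarrow> int \<Rightarrow> int \<Rightarrow> real) \<Rightarrow> (int ^ 'n) \<times> (int ^ 'n) \<Rightarrow> real" where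
  "DR_cost c = (\<lambda>(d, b). \<Sum>i\<in>UNIV. c i (d $ i) (b $ i))"

definition DR_feasible ::
  "int ^ 'n \<Rightarrow> int ^ 'n \<Rightarrow> int \<Rightarrow> int ^ 'n \<Rightarrow> int ^ 'n \<Rightarrow> ((int ^ 'n) \<times> (int ^ 'n)) set" where
  "DR_feasible dbar bbar \<gamma> l u =
     {(d, b). 0 \<le> d \<and> 0 \<le> b \<and>
        vec_sum d + vec_sum b = vec_sum dbar + vec_sum bbar \<and>
        vec_sum b \<le> vec_sum bbar \<and>
        l1_norm ((d + b) - (dbar + bbar)) \<le> 2 * \<gamma> \<and>
        l \<le> d + b \<and> d + b \<le> u}"

definition DR_optimal ::
  "int ^ 'n \<Rightarrow> int ^ 'n \<Rightarrow> int \<Rightarrow> int ^ 'n \<Rightarrow> int ^ 'n \<Rightarrow> ('n \<Rightarrow> int \<Rightarrow> int \<Rightarrow> real) \<Rightarrow>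
   (int ^ 'n) \<times> (int ^ 'n) \<Rightarrow> bool" where
  "DR_optimal dbar bbar \<gamma> l u c =
     is_arg_min (DR_cost c) (\<lambda>x. x \<in> DR_feasible dbar bbar \<gamma> l u)"

definition scaled_DR_feasible ::
  "int ^ 'n \<Rightarrow> int ^ 'n \<Rightarrow> int \<Rightarrow> int ^ 'n \<Rightarrow> int ^ 'n \<Rightarrow> (int ^ 'n) \<times> (int ^ 'n) \<Rightarrow> int \<Rightarrow>
   ((int ^ 'n) \<times> (int ^ 'n)) set" where
  "scaled_DR_feasible dbar bbar \<gamma> l u = (\<lambda>(d0, b0) lam.
     {(d, b) \<in> DR_feasible dbar bbar \<gamma> l u.
        \<forall>i. [d $ i = d0 $ i] (mod lam) \<and> [b $ i = b0 $ i] (mod lam)})"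

definition scaled_DR_optimal ::
  "int ^ 'n \<Rightarrow> int ^ 'n \<Rightarrow> int \<Rightarrow> int ^ 'n \<Rightarrow> int ^ 'n \<Rightarrow> ('n \<Rightarrow> int \<Rightarrow> int \<Rightarrow> real) \<Rightarrow>
   (int ^ 'n) \<times> (int ^ 'n) \<Rightarrow> int \<Rightarrow> (int ^ 'n) \<times> (int ^ 'n) \<Rightarrow> bool" where
  "scaled_DR_optimal dbar bbar \<gamma> l u c x0 lam =
     is_arg_min (DR_cost c) (\<lambda>x. x \<in> scaled_DR_feasible dbar bbar \<gamma> l u x0 lam)"

end

theory Submission
  imports Defs
begin

text \<open>
  Let \<open>y\<close> be an optimal solution of the scaled problem and \<open>z\<close> an optimal solution of the original
  problem that is as close to \<open>y\<close> as possible. If some nonzero vector \<open>v\<close>, all of whose entries are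
  multiples of \<open>\<lambda>\<close>, keeps \<open>y + v\<close> and \<open>z - v\<close> feasible and satisfies
  \<open>c (y + v) + c (z - v) \<le> c y + c z\<close>, then optimality of \<open>y\<close> forces \<open>z - v\<close> to be optimal, and when
  \<open>v\<close> is a partial move from \<open>y\<close> to \<open>z\<close> the point \<open>z - v\<close> is closer to \<open>y\<close>, which is impossible. So it
  suffices to produce such a \<open>v\<close> whenever \<open>y\<close> and \<open>z\<close> are more than \<open>10 n \<lambda>\<close> apart
  (\<open>exchange_closer\<close>).

  The move of a single index from \<open>y\<close> to \<open>z\<close> is split into unit moves in two adjacent directions among
  \<open>\<plusminus>(1, 0)\<close>, \<open>\<plusminus>(0, 1)\<close>, \<open>\<plusminus>(1, -1)\<close>; a multimodular function is directionally convex in the cone of any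
  two adjacent directions, so every partial move satisfies the exchange inequality. The
  moves of all indices are recorded as a flow on four nodes \<open>Dock\<close>, \<open>Bike\<close>, \<open>Upper\<close>, \<open>Lower\<close>: raising
  \<open>d\<close> (or \<open>b\<close>) by one is a unit of flow leaving \<open>Dock\<close> (or \<open>Bike\<close>), which enters \<open>Upper\<close> or \<open>Lower\<close>
  according to whether \<open>d + b\<close> moves above or below \<open>dbar + bbar\<close>; lowering reverses the arc, and trading
  a bike for a dock is a unit from \<open>Dock\<close> to \<open>Bike\<close>. In this picture all the coupling constraints of the
  problem become flow conservation, after the slack of the two inequality constraints is added as
  extra flow between \<open>Dock\<close> and \<open>Bike\<close> and between \<open>Upper\<close> and \<open>Lower\<close> (\<open>exchange_flow_exists\<close>).

  Call an arc good if a single index, or the slack, carries at least \<open>\<lambda>\<close> units on it. A directed cycle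
  of good arcs carries \<open>\<lambda>\<close> units of a circulation, and this is the required \<open>v\<close>. If there is no such
  cycle, the nodes can be ordered so that all backward arcs are bad. Since every circulation is
  orthogonal to potential differences, a suitable potential then bounds the total flow from
  \<open>{Dock, Bike}\<close> to \<open>{Upper, Lower}\<close> by the flow on bad arcs, which is at most \<open>4 \<lambda>\<close> for each index and
  \<open>2 \<lambda>\<close> for the slack. But that total flow is half the distance of \<open>y\<close> and \<open>z\<close>, hence
  more than \<open>5 n \<lambda>\<close>, and this is at least \<open>4 n \<lambda> + 2 \<lambda>\<close> as soon as \<open>n \<ge> 2\<close>; with a single index the
  distance is \<open>0\<close> (\<open>circulation_exists\<close>).
\<close>

section \<open>Exchange inequalities for multimodular functions\<close>

text \<open>
  If the increments of \<open>g\<close> in the first direction are monotone under unit steps in either direction,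
  they are monotone along the whole rectangle: first move in \<open>s\<close>, then in \<open>t\<close>.
\<close>

lemma increment_mono_step:
  fixes g :: "int \<Rightarrow> int \<Rightarrow> real"
  assumes ss: "\<And>s t. 0 \<le> s \<Longrightarrow> s + 2 \<le> S \<Longrightarrow> 0 \<le> t \<Longrightarrow> t \<le> T \<Longrightarrow>
                 g (s + 1) t - g s t \<le> g (s + 2) t - g (s + 1) t"
    and st: "\<And>s t. 0 \<le> s \<Longrightarrow> s + 1 \<le> S \<Longrightarrow> 0 \<le> t \<Longrightarrow> t + 1 \<le> T \<Longrightarrow>
                 g (s + 1) t - g s t \<le> g (s + 1) (t + 1) - g s (t + 1)"
    and "0 \<le> p" "p \<le> p'" "p' + 1 \<le> S" "0 \<le> q" "q \<le> q'" "q' \<le> T"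
  shows "g (p + 1) q - g p q \<le> g (p' + 1) q' - g p' q'"
proof -
  have "p' + 1 \<le> S \<longrightarrow> g (p + 1) q - g p q \<le> g (p' + 1) q - g p' q"
    using \<open>p \<le> p'\<close>
  proof (induction p' rule: int_ge_induct)
    case base
    show ?case by simp
  next
    case (step i)
    then show ?case
      using ss[of i q] assms(3-) by (auto simp: algebra_simps)
  qed
  moreover have "q' \<le> T \<longrightarrow> g (p' + 1) q - g p' q \<le> g (p' + 1) q' - g p' q'"
    using \<open>q \<le> q'\<close>
  proof (induction q' rule: int_ge_induct)
    case base
    show ?case by simp
  next
    case (step i)
    then show ?case
      using st[of p' i] assms(3-) by auto
  qed
  ultimately show ?thesis using assms by linarith
qed

lemma increment_mono:
  fixes g :: "int \<Rightarrow> int \<Rightarrow> real"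
  assumes ss: "\<And>s t. 0 \<le> s \<Longrightarrow> s + 2 \<le> S \<Longrightarrow> 0 \<le> t \<Longrightarrow> t \<le> T \<Longrightarrow>
                 g (s + 1) t - g s t \<le> g (s + 2) t - g (s + 1) t"
    and st: "\<And>s t. 0 \<le> s \<Longrightarrow> s + 1 \<le> S \<Longrightarrow> 0 \<le> t \<Longrightarrow> t + 1 \<le> T \<Longrightarrow>
                 g (s + 1) t - g s t \<le> g (s + 1) (t + 1) - g s (t + 1)"
    and "0 \<le> k" "0 \<le> p" "p \<le> p'" "p' + k \<le> S" "0 \<le> q" "q \<le> q'" "q' \<le> T"
  shows "g (p + k) q - g p q \<le> g (p' + k) q' - g p' q'"
proof -
  have "p' + k \<le> S \<longrightarrow> g (p + k) q - g p q \<le> g (p' + k) q' - g p' q'"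
    using \<open>0 \<le> k\<close>
  proof (induction k rule: int_ge_induct)
    case base
    show ?case by simp
  next
    case (step i)
    have "g (p + i + 1) q - g (p + i) q \<le> g (p' + i + 1) q' - g (p' + i) q'" if "p' + (i + 1) \<le> S"
      by (rule increment_mono_step[of S T g, OF ss st]) (use that step(1) assms(4-) in auto)
    then show ?case using step by (auto simp: algebra_simps)
  qed
  then show ?thesis using assms by blast
qed

text \<open>
  Walk from the corner \<open>(0, 0)\<close> to \<open>(s, t)\<close>, first horizontally and then vertically, and likewise
  from \<open>(S - s, T - t)\<close> to the opposite corner \<open>(S, T)\<close>. Each leg of the second walk is the translate
  of a leg of the first by a nonnegative vector, so \<open>g\<close> grows at least as much along it.
\<close>

lemma directionally_convex_exchange:
  fixes g :: "int \<Rightarrow> int \<Rightarrow> real"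
  assumes ss: "\<And>s t. 0 \<le> s \<Longrightarrow> s + 2 \<le> S \<Longrightarrow> 0 \<le> t \<Longrightarrow> t \<le> T \<Longrightarrow>
                 g (s + 1) t - g s t \<le> g (s + 2) t - g (s + 1) t"
    and st: "\<And>s t. 0 \<le> s \<Longrightarrow> s + 1 \<le> S \<Longrightarrow> 0 \<le> t \<Longrightarrow> t + 1 \<le> T \<Longrightarrow>
                 g (s + 1) t - g s t \<le> g (s + 1) (t + 1) - g s (t + 1)"
    and tt: "\<And>s t. 0 \<le> s \<Longrightarrow> s \<le> S \<Longrightarrow> 0 \<le> t \<Longrightarrow> t + 2 \<le> T \<Longrightarrow>
                 g s (t + 1) - g s t \<le> g s (t + 2) - g s (t + 1)"
    and s: "0 \<le> s" "s \<le> S" and t: "0 \<le> t" "t \<le> T"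
  shows "g s t + g (S - s) (T - t) \<le> g 0 0 + g S T"
proof -
  have "g (0 + s) 0 - g 0 0 \<le> g ((S - s) + s) (T - t) - g (S - s) (T - t)"
    by (rule increment_mono[of S T g, OF ss st]) (use s t in auto)
  moreover have "g s (0 + t) - g s 0 \<le> g S ((T - t) + t) - g S (T - t)"
    by (rule increment_mono[of T S "\<lambda>t s. g s t"]) (use s t tt st in \<open>force+\<close>)
  ultimately show ?thesis by simp
qed

text \<open>
  The defining inequalities say that the mixed second differences along the pairs of directions
  \<open>(1, 0), (0, 1)\<close> and \<open>(0, 1), (-1, 1)\<close> and \<open>(1, 0), (1, -1)\<close> are nonnegative. Here they are shifted so
  that the smallest arguments involved are exactly \<open>\<alpha>\<close> and \<open>\<beta>\<close>.
\<close>

lemma multimodularD: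
  assumes "multimodular f" "0 \<le> \<alpha>" "0 \<le> \<beta>"
  shows "f (\<alpha> + 1) \<beta> - f \<alpha> \<beta> \<le> f (\<alpha> + 1) (\<beta> + 1) - f \<alpha> (\<beta> + 1)"
    and "f (\<alpha> + 1) (\<beta> + 1) - f (\<alpha> + 1) \<beta> \<le> f \<alpha> (\<beta> + 2) - f \<alpha> (\<beta> + 1)"
    and "f (\<alpha> + 1) (\<beta> + 1) - f \<alpha> (\<beta> + 1) \<le> f (\<alpha> + 2) \<beta> - f (\<alpha> + 1) \<beta>"
proof -
  show "f (\<alpha> + 1) \<beta> - f \<alpha> \<beta> \<le> f (\<alpha> + 1) (\<beta> + 1) - f \<alpha> (\<beta> + 1)"
    using assms unfolding multimodular_def by smt
  have shift: "(\<alpha> + 1) - 1 = \<alpha>" "(\<beta> + 1) - 1 = \<beta>" "(\<alpha> + 1) + 1 = \<alpha> + 2" "(\<beta> + 1) + 1 = \<beta> + 2"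
    by auto
  have "\<alpha> + 1 \<ge> 1 \<and> \<beta> + 1 \<ge> 1" using assms by auto
  with assms(1) have "f ((\<alpha> + 1) - 1) ((\<beta> + 1) + 1) - f ((\<alpha> + 1) - 1) (\<beta> + 1)
          \<ge> f (\<alpha> + 1) (\<beta> + 1) - f (\<alpha> + 1) ((\<beta> + 1) - 1)"
      "f ((\<alpha> + 1) + 1) ((\<beta> + 1) - 1) - f (\<alpha> + 1) ((\<beta> + 1) - 1)
          \<ge> f (\<alpha> + 1) (\<beta> + 1) - f ((\<alpha> + 1) - 1) (\<beta> + 1)"
    unfolding multimodular_def by blast+
  then show "f (\<alpha> + 1) (\<beta> + 1) - f (\<alpha> + 1) \<beta> \<le> f \<alpha> (\<beta> + 2) - f \<alpha> (\<beta> + 1)"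
    "f (\<alpha> + 1) (\<beta> + 1) - f \<alpha> (\<beta> + 1) \<le> f (\<alpha> + 2) \<beta> - f (\<alpha> + 1) \<beta>"
    unfolding shift by auto
qed

lemma multimodular_transpose: "multimodular f \<Longrightarrow> multimodular (\<lambda>\<alpha> \<beta>. f \<beta> \<alpha>)"
  unfolding multimodular_def by (smt (verit, best))

text \<open>
  The rays through \<open>\<plusminus>(1, 0)\<close>, \<open>\<plusminus>(0, 1)\<close>, \<open>\<plusminus>(1, -1)\<close> cut the plane into six cones, and the pair of
  directions spanning a cone is always one of the three pairs of the definition, up to sign.
  Second differences along a single direction are sums of two mixed ones. Hence a
  multimodular function is directionally convex in the coordinates of each cone. The orthant and
  the cone of \<open>(1, 0)\<close> and \<open>(1, -1)\<close> represent all six up to transposition and up to interchanging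
  the two end points.
\<close>

lemma exchange_orthant:
  assumes f: "multimodular f" and "0 \<le> \<alpha>" "0 \<le> \<beta>"
    and "0 \<le> s" "s \<le> S" "0 \<le> t" "t \<le> T"
  shows "f (\<alpha> + s) (\<beta> + t) + f (\<alpha> + (S - s)) (\<beta> + (T - t)) \<le> f \<alpha> \<beta> + f (\<alpha> + S) (\<beta> + T)"
proof -
  have "f (\<alpha> + s) (\<beta> + t) + f (\<alpha> + (S - s)) (\<beta> + (T - t)) \<le> f (\<alpha> + 0) (\<beta> + 0) + f (\<alpha> + S) (\<beta> + T)"
  proof (rule directionally_convex_exchange[where g = "\<lambda>s t. f (\<alpha> + s) (\<beta> + t)"])
    fix s t :: int
    assume nn: "0 \<le> s" "0 \<le> t"
    note D = multimodularD[OF f, of "\<alpha> + s" "\<beta> + t"]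
    show "f (\<alpha> + (s + 1)) (\<beta> + t) - f (\<alpha> + s) (\<beta> + t)
        \<le> f (\<alpha> + (s + 2)) (\<beta> + t) - f (\<alpha> + (s + 1)) (\<beta> + t)"
      using D nn assms(2,3) by (simp add: algebra_simps)
    show "f (\<alpha> + (s + 1)) (\<beta> + t) - f (\<alpha> + s) (\<beta> + t)
        \<le> f (\<alpha> + (s + 1)) (\<beta> + (t + 1)) - f (\<alpha> + s) (\<beta> + (t + 1))"
      using D nn assms(2,3) by (simp add: algebra_simps)
    show "f (\<alpha> + s) (\<beta> + (t + 1)) - f (\<alpha> + s) (\<beta> + t)
        \<le> f (\<alpha> + s) (\<beta> + (t + 2)) - f (\<alpha> + s) (\<beta> + (t + 1))"
      using D nn assms(2,3) by (simp add: algebra_simps)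
  qed (use assms in auto)
  then show ?thesis by simp
qed

lemma exchange_obtuse_cone:
  assumes f: "multimodular f" and "0 \<le> \<alpha>" "T \<le> \<beta>"
    and "0 \<le> s" "s \<le> S" "0 \<le> t" "t \<le> T"
  shows "f (\<alpha> + s + t) (\<beta> - t) + f (\<alpha> + (S - s) + (T - t)) (\<beta> - (T - t))
       \<le> f \<alpha> \<beta> + f (\<alpha> + S + T) (\<beta> - T)"
proof -
  have "f (\<alpha> + s + t) (\<beta> - t) + f (\<alpha> + (S - s) + (T - t)) (\<beta> - (T - t))
       \<le> f (\<alpha> + 0 + 0) (\<beta> - 0) + f (\<alpha> + S + T) (\<beta> - T)"
  proof (rule directionally_convex_exchange[where g = "\<lambda>s t. f (\<alpha> + s + t) (\<beta> - t)"])
    fix s t :: int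
    assume nn: "0 \<le> s" "0 \<le> t"
    {
      assume "t \<le> T"
      then show "f (\<alpha> + (s + 1) + t) (\<beta> - t) - f (\<alpha> + s + t) (\<beta> - t)
        \<le> f (\<alpha> + (s + 2) + t) (\<beta> - t) - f (\<alpha> + (s + 1) + t) (\<beta> - t)"
        using multimodularD[OF f, of "\<alpha> + s + t" "\<beta> - t"] nn assms(2,3)
        by (simp add: algebra_simps)
    next
      assume "t + 1 \<le> T"
      then show "f (\<alpha> + (s + 1) + t) (\<beta> - t) - f (\<alpha> + s + t) (\<beta> - t)
        \<le> f (\<alpha> + (s + 1) + (t + 1)) (\<beta> - (t + 1)) - f (\<alpha> + s + (t + 1)) (\<beta> - (t + 1))"
        using multimodularD(3)[OF f, of "\<alpha> + s + t" "\<beta> - t - 1"] nn assms(2,3)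
        by (simp add: algebra_simps)
    next
      assume "t + 2 \<le> T"
      then show "f (\<alpha> + s + (t + 1)) (\<beta> - (t + 1)) - f (\<alpha> + s + t) (\<beta> - t)
        \<le> f (\<alpha> + s + (t + 2)) (\<beta> - (t + 2)) - f (\<alpha> + s + (t + 1)) (\<beta> - (t + 1))"
        using multimodularD(2,3)[OF f, of "\<alpha> + s + t" "\<beta> - t - 2"] nn assms(2,3)
        by (simp add: algebra_simps)
    }
  qed (use assms in auto)
  then show ?thesis by simp
qed

section \<open>The move of one index as a flow on four nodes\<close>

text \<open>
  An index of the problem moves from \<open>(d, b)\<close> to \<open>(d', b')\<close>. Its move is recorded as a flow whose net
  outflow from \<open>Dock\<close> is \<open>d' - d\<close>, from \<open>Bike\<close> is \<open>b' - b\<close>, and whose net inflow into \<open>Upper\<close> is the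
  change of \<open>max (d + b - a) 0\<close>, where \<open>a\<close> is the reference value of \<open>d + b\<close>. The net inflow into
  \<open>Lower\<close> is then the change of \<open>min (d + b) a\<close>.
\<close>

datatype node = Dock | Bike | Upper | Lower

lemma UNIV_node: "UNIV = {Dock, Bike, Upper, Lower}"
  using node.exhaust by auto

instance node :: finite
  by standard (simp add: UNIV_node)

definition net :: "(node \<Rightarrow> node \<Rightarrow> int) \<Rightarrow> node \<Rightarrow> int" where
  "net m u = (\<Sum>v\<in>UNIV. m u v - m v u)"

text \<open>
  For vectors with a prescribed total, the \<open>l1\<close> distance to a reference vector with the same total is
  twice the sum of the excesses. Unlike the absolute value, the excess changes by \<open>0\<close> or \<open>1\<close> in a unit
  upward move, so it can be counted by flow entering \<open>Upper\<close>.
\<close>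

definition excess :: "int \<Rightarrow> int \<Rightarrow> int" where
  "excess a x = max (x - a) 0"

definition between_zero :: "int \<Rightarrow> int \<Rightarrow> bool" where
  "between_zero v w \<longleftrightarrow> min 0 w \<le> v \<and> v \<le> max 0 w"

text \<open>
  The flow \<open>k\<close> is meant as a part of the move from \<open>(d, b)\<close> to \<open>(d', b')\<close> that is carried out at the
  first point and undone at the second one. The flow into \<open>Upper\<close> only bounds
  the two excesses from above: when the whole move crosses the reference value, a unit counted
  for \<open>Upper\<close> may still move the lower point below that value, where its excess does not change.
\<close>

definition exchange_step ::
  "(int \<Rightarrow> int \<Rightarrow> real) \<Rightarrow> int \<Rightarrow> int \<Rightarrow> int \<Rightarrow> int \<Rightarrow> int \<Rightarrow> (node \<Rightarrow> node \<Rightarrow> int) \<Rightarrow> bool"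
where
  "exchange_step f a d b d' b' k \<longleftrightarrow>
     f (d + net k Dock) (b + net k Bike) + f (d' - net k Dock) (b' - net k Bike) \<le> f d b + f d' b' \<and>
     excess a (d + b + (net k Dock + net k Bike)) \<le> excess a (d + b) - net k Upper \<and>
     excess a (d' + b' - (net k Dock + net k Bike)) \<le> excess a (d' + b') + net k Upper \<and>
     between_zero (net k Dock) (d' - d) \<and> between_zero (net k Bike) (b' - b) \<and>
     between_zero (net k Dock + net k Bike) (d' + b' - (d + b)) \<and>
     ((\<exists>u v. k u v \<noteq> 0) \<longrightarrow> net k Dock \<noteq> 0 \<or> net k Bike \<noteq> 0)"

text \<open>
  One set for each of the six cones of directions: the flow of a move in that cone
  uses only arcs that leave this set. For example, the cone of \<open>(1, 0)\<close> and \<open>(1, -1)\<close> uses arcs that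
  leave \<open>Dock\<close>, and the opposite cone uses arcs that enter \<open>Dock\<close>.
\<close>

definition cone_tails :: "node set set" where
  "cone_tails = {{Dock}, {Bike}, {Dock, Bike}, -{Dock}, -{Bike}, -{Dock, Bike}}"

definition cone_flow :: "(node \<Rightarrow> node \<Rightarrow> int) \<Rightarrow> bool" where
  "cone_flow m \<longleftrightarrow> (\<forall>u v. 0 \<le> m u v) \<and>
     (\<exists>S \<in> cone_tails.
        \<forall>u v. m u v \<noteq> 0 \<longrightarrow> u \<in> S \<and> v \<notin> S)"

definition exchange_flow ::
  "(int \<Rightarrow> int \<Rightarrow> real) \<Rightarrow> int \<Rightarrow> int \<Rightarrow> int \<Rightarrow> int \<Rightarrow> int \<Rightarrow> (node \<Rightarrow> node \<Rightarrow> int) \<Rightarrow> bool"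
where
  "exchange_flow f a d b d' b' m \<longleftrightarrow>
     cone_flow m \<and> net m Dock = d' - d \<and> net m Bike = b' - b \<and>
     net m Upper = excess a (d + b) - excess a (d' + b') \<and>
     (\<forall>k. (\<forall>u v. 0 \<le> k u v \<and> k u v \<le> m u v) \<longrightarrow> exchange_step f a d b d' b' k)"

lemma net_transpose: "net (\<lambda>u v. k v u) u = - net k u"
  by (simp add: net_def UNIV_node)

lemma exchange_step_reverse:
  assumes "exchange_step f a d b d' b' k"
  shows "exchange_step f a d' b' d b (\<lambda>u v. k v u)"
proof -
  note net = net_transpose[of k Dock] net_transpose[of k Bike] net_transpose[of k Upper]
  have neg: "between_zero (- v) (y - x)" if "between_zero v (x - y)" for v x y
    using that unfolding between_zero_def by linarith
  have "between_zero (- net k Dock + - net k Bike) (d + b - (d' + b'))"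
    using assms neg[of "net k Dock + net k Bike"] unfolding exchange_step_def by simp
  moreover have e: "d' + b' + (- net k Dock + - net k Bike) = d' + b' - (net k Dock + net k Bike)"
    "d + b - (- net k Dock + - net k Bike) = d + b + (net k Dock + net k Bike)"
    by auto
  moreover have "between_zero (- net k Dock) (d - d')" "between_zero (- net k Bike) (b - b')"
    using assms neg unfolding exchange_step_def by blast+
  ultimately show ?thesis
    using assms unfolding exchange_step_def net e by force
qed

lemma cone_flow_reverse:
  assumes "cone_flow m"
  shows "cone_flow (\<lambda>u v. m v u)"
proof -
  from assms obtain S where S: "S \<in> cone_tails"
    "\<forall>u v. m u v \<noteq> 0 \<longrightarrow> u \<in> S \<and> v \<notin> S" and "\<forall>u v. 0 \<le> m u v"
    unfolding cone_flow_def by blast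
  moreover have "-S \<in> cone_tails"
    using S(1) by (auto simp: cone_tails_def)
  ultimately show ?thesis
    unfolding cone_flow_def by (intro conjI bexI[of _ "-S"]) auto
qed

lemma exchange_flow_reverse:
  assumes "exchange_flow f a d b d' b' m"
  shows "exchange_flow f a d' b' d b (\<lambda>u v. m v u)"
proof -
  have "exchange_step f a d' b' d b k" if "\<forall>u v. 0 \<le> k u v \<and> k u v \<le> m v u" for k
  proof -
    have "(\<forall>u v. 0 \<le> k v u \<and> k v u \<le> m u v) \<longrightarrow> exchange_step f a d b d' b' (\<lambda>u v. k v u)"
      using assms unfolding exchange_flow_def by (elim conjE allE[of _ "\<lambda>u v. k v u"])
    with that have "exchange_step f a d b d' b' (\<lambda>u v. k v u)"
      by simp
    from exchange_step_reverse[OF this] show ?thesis .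
  qed
  with assms show ?thesis
    unfolding exchange_flow_def net_transpose[of m Dock] net_transpose[of m Bike]
      net_transpose[of m Upper]
    by (auto intro: cone_flow_reverse)
qed

text \<open>
  The rise of \<open>d + b\<close> first fills up the part below \<open>a\<close> and then the part above, which has length \<open>g\<close>.
  A partial move of \<open>p \<le> g\<close> units into \<open>Upper\<close> and at most as many units into \<open>Lower\<close> as there is room
  below \<open>a\<close> raises the excess of the lower end by at most \<open>p\<close>, since the lower end meets the part below \<open>a\<close>
  first, and lowers the excess of the upper end by at least \<open>p\<close>, since the upper end meets the part
  above \<open>a\<close> first. So any way of distributing the units that leave \<open>Dock\<close> and \<open>Bike\<close> over
  \<open>Upper\<close> and \<open>Lower\<close> will do.
\<close>

lemma exchange_flow_upward:
  assumes f: "multimodular f" and nn: "0 \<le> d" "0 \<le> b" "0 \<le> d'" "0 \<le> b'"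
    and up: "d + b \<le> d' + b'"
  shows "\<exists>m. exchange_flow f a d b d' b' m"
proof -
  define g where "g = excess a (d' + b') - excess a (d + b)"
  have g: "0 \<le> g" "g \<le> d' + b' - (d + b)"
    using up by (auto simp: g_def excess_def)
  have rise: "excess a (d + b + (p + q)) \<le> excess a (d + b) + p"
    "excess a (d' + b' - (p + q)) \<le> excess a (d' + b') - p"
    if "0 \<le> p" "p \<le> g" "0 \<le> q" "q \<le> d' + b' - (d + b) - g" for p q
    using that up unfolding g_def excess_def by linarith+
  consider (orthant) "d \<le> d'" "b \<le> b'" | (swap) "d \<le> d'" "b' \<le> b" | (swap') "d' \<le> d" "b \<le> b'"
    using up by linarith
  then show ?thesis
  proof cases
    case orthant
    \<comment> \<open>send as much of the flow from \<open>Dock\<close> as possible to \<open>Upper\<close>\<close>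
    define e where "e = min (d' - d) g"
    define m where "m = (\<lambda>u v. case (u, v) of
        (Dock, Upper) \<Rightarrow> e | (Dock, Lower) \<Rightarrow> d' - d - e
      | (Bike, Upper) \<Rightarrow> g - e | (Bike, Lower) \<Rightarrow> b' - b - (g - e) | _ \<Rightarrow> 0)"
    have e: "0 \<le> e" "e \<le> d' - d" "e \<le> g" "g - e \<le> b' - b"
      using orthant g by (auto simp: e_def)
    have "exchange_step f a d b d' b' k" if "\<forall>u v. 0 \<le> k u v \<and> k u v \<le> m u v" for k
    proof -
      have k: "0 \<le> k u v" "k u v \<le> m u v" for u v using that by auto
      have [simp]: "k u v = 0" if "m u v = 0" for u v
        using k[of u v] that by simp
      let ?s = "k Dock Upper + k Dock Lower" and ?t = "k Bike Upper + k Bike Lower"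
      have net: "net k Dock = ?s" "net k Bike = ?t" "net k Upper = - (k Dock Upper + k Bike Upper)"
        by (simp_all add: net_def UNIV_node m_def)
      note k1 = k[of Dock Upper] k[of Dock Lower] k[of Bike Upper] k[of Bike Lower]
      have b: "0 \<le> ?s" "?s \<le> d' - d" "0 \<le> ?t" "?t \<le> b' - b"
        using k1 by (simp_all add: m_def)
      have "f (d + ?s) (b + ?t) + f (d' - ?s) (b' - ?t) \<le> f d b + f d' b'"
        using exchange_orthant[OF f nn(1,2) b] by (simp add: algebra_simps)
      moreover have "?s = 0 \<and> ?t = 0 \<longrightarrow> k u v = 0" for u v
        using k1 by (cases u; cases v) (auto simp: m_def)
      moreover have "excess a (d + b + (net k Dock + net k Bike)) \<le> excess a (d + b) - net k Upper"
        "excess a (d' + b' - (net k Dock + net k Bike)) \<le> excess a (d' + b') + net k Upper"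
        using rise[of "k Dock Upper + k Bike Upper" "k Dock Lower + k Bike Lower"] k1 unfolding net
        by (simp_all add: m_def algebra_simps)
      moreover have "between_zero (net k Dock) (d' - d)" "between_zero (net k Bike) (b' - b)"
        "between_zero (net k Dock + net k Bike) (d' + b' - (d + b))"
        using b orthant up unfolding net between_zero_def by linarith+
      ultimately show ?thesis
        unfolding exchange_step_def net by blast
    qed
    moreover have "cone_flow m"
      unfolding cone_flow_def using e
      by (intro conjI bexI[of _ "{Dock, Bike}"]) (auto simp: m_def cone_tails_def split: node.splits)
    moreover have "net m Dock = d' - d" "net m Bike = b' - b" "net m Upper = - g"
      by (simp_all add: net_def UNIV_node m_def)
    ultimately show ?thesis
      unfolding exchange_flow_def g_def by (intro exI[of _ m]) auto
  next
    case swap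
    define m where "m = (\<lambda>u v. case (u, v) of
        (Dock, Upper) \<Rightarrow> g | (Dock, Lower) \<Rightarrow> d' + b' - (d + b) - g
      | (Dock, Bike) \<Rightarrow> b - b' | _ \<Rightarrow> 0)"
    have "exchange_step f a d b d' b' k" if "\<forall>u v. 0 \<le> k u v \<and> k u v \<le> m u v" for k
    proof -
      have k: "0 \<le> k u v" "k u v \<le> m u v" for u v using that by auto
      have [simp]: "k u v = 0" if "m u v = 0" for u v
        using k[of u v] that by simp
      let ?s = "k Dock Upper + k Dock Lower" and ?t = "k Dock Bike"
      have net: "net k Dock = ?s + ?t" "net k Bike = - ?t" "net k Upper = - k Dock Upper"
        by (simp_all add: net_def UNIV_node m_def)
      note k1 = k[of Dock Upper] k[of Dock Lower] k[of Dock Bike]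
      have b: "0 \<le> ?s" "?s \<le> d' + b' - (d + b)" "0 \<le> ?t" "?t \<le> b - b'"
        using k1 by (simp_all add: m_def)
      have "f (d + (?s + ?t)) (b + - ?t) + f (d' - (?s + ?t)) (b' - - ?t) \<le> f d b + f d' b'"
        using exchange_obtuse_cone[OF f nn(1) _ b, of b] nn(4) by (simp add: algebra_simps)
      moreover have "?s + ?t = 0 \<and> - ?t = 0 \<longrightarrow> k u v = 0" for u v
        using k1 by (cases u; cases v) (auto simp: m_def)
      moreover have "excess a (d + b + (net k Dock + net k Bike)) \<le> excess a (d + b) - net k Upper"
        "excess a (d' + b' - (net k Dock + net k Bike)) \<le> excess a (d' + b') + net k Upper"
        using rise[of "k Dock Upper" "k Dock Lower"] k1 unfolding net
        by (simp_all add: m_def algebra_simps)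
      moreover have "between_zero (net k Dock) (d' - d)" "between_zero (net k Bike) (b' - b)"
        "between_zero (net k Dock + net k Bike) (d' + b' - (d + b))"
        using b swap up unfolding net between_zero_def by linarith+
      ultimately show ?thesis
        unfolding exchange_step_def net by blast
    qed
    moreover have "cone_flow m"
      unfolding cone_flow_def using g swap
      by (intro conjI bexI[of _ "{Dock}"]) (auto simp: m_def cone_tails_def split: node.splits)
    moreover have "net m Dock = d' - d" "net m Bike = b' - b" "net m Upper = - g"
      by (simp_all add: net_def UNIV_node m_def)
    ultimately show ?thesis
      unfolding exchange_flow_def g_def by (intro exI[of _ m]) auto
  next
    case swap'
    define m where "m = (\<lambda>u v. case (u, v) of
        (Bike, Upper) \<Rightarrow> g | (Bike, Lower) \<Rightarrow> d' + b' - (d + b) - g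
      | (Bike, Dock) \<Rightarrow> d - d' | _ \<Rightarrow> 0)"
    have "exchange_step f a d b d' b' k" if "\<forall>u v. 0 \<le> k u v \<and> k u v \<le> m u v" for k
    proof -
      have k: "0 \<le> k u v" "k u v \<le> m u v" for u v using that by auto
      have [simp]: "k u v = 0" if "m u v = 0" for u v
        using k[of u v] that by simp
      let ?s = "k Bike Upper + k Bike Lower" and ?t = "k Bike Dock"
      have net: "net k Dock = - ?t" "net k Bike = ?s + ?t" "net k Upper = - k Bike Upper"
        by (simp_all add: net_def UNIV_node m_def)
      note k1 = k[of Bike Upper] k[of Bike Lower] k[of Bike Dock]
      have b: "0 \<le> ?s" "?s \<le> d' + b' - (d + b)" "0 \<le> ?t" "?t \<le> d - d'"
        using k1 by (simp_all add: m_def)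
      have "f (d + - ?t) (b + (?s + ?t)) + f (d' - - ?t) (b' - (?s + ?t)) \<le> f d b + f d' b'"
        using exchange_obtuse_cone[OF multimodular_transpose[OF f] nn(2) _ b, of d] nn(3)
        by (simp add: algebra_simps)
      moreover have "- ?t = 0 \<and> ?s + ?t = 0 \<longrightarrow> k u v = 0" for u v
        using k1 by (cases u; cases v) (auto simp: m_def)
      moreover have "excess a (d + b + (net k Dock + net k Bike)) \<le> excess a (d + b) - net k Upper"
        "excess a (d' + b' - (net k Dock + net k Bike)) \<le> excess a (d' + b') + net k Upper"
        using rise[of "k Bike Upper" "k Bike Lower"] k1 unfolding net
        by (simp_all add: m_def algebra_simps)
      moreover have "between_zero (net k Dock) (d' - d)" "between_zero (net k Bike) (b' - b)"
        "between_zero (net k Dock + net k Bike) (d' + b' - (d + b))"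
        using b swap' up unfolding net between_zero_def by linarith+
      ultimately show ?thesis
        unfolding exchange_step_def net by blast
    qed
    moreover have "cone_flow m"
      unfolding cone_flow_def using g swap'
      by (intro conjI bexI[of _ "{Bike}"]) (auto simp: m_def cone_tails_def split: node.splits)
    moreover have "net m Dock = d' - d" "net m Bike = b' - b" "net m Upper = - g"
      by (simp_all add: net_def UNIV_node m_def)
    ultimately show ?thesis
      unfolding exchange_flow_def g_def by (intro exI[of _ m]) auto
  qed
qed

lemma exchange_flow_exists:
  assumes "multimodular f" "0 \<le> d" "0 \<le> b" "0 \<le> d'" "0 \<le> b'"
  shows "\<exists>m. exchange_flow f a d b d' b' m"
proof (cases "d + b \<le> d' + b'")
  case True
  then show ?thesis using exchange_flow_upward assms by blast
next
  case False
  then obtain m where "exchange_flow f a d' b' d b m"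
    using exchange_flow_upward[OF assms(1,4,5,2,3)] by fastforce
  from exchange_flow_reverse[OF this] show ?thesis by blast
qed

section \<open>Circulations in multiples of the step length\<close>

definition up_flow :: "(node \<Rightarrow> node \<Rightarrow> int) \<Rightarrow> int" where
  "up_flow m = m Dock Upper + m Dock Lower + m Bike Upper + m Bike Lower"

lemma up_flow_eq:
  assumes "cone_flow m"
  shows "up_flow m = max 0 (net m Dock + net m Bike)"
proof -
  from assms obtain S where S: "S \<in> cone_tails"
    and supp: "\<And>u v. m u v \<noteq> 0 \<Longrightarrow> u \<in> S \<and> v \<notin> S" and nn: "\<And>u v. 0 \<le> m u v"
    unfolding cone_flow_def by blast
  have z: "m u v = 0" if "u \<notin> S \<or> v \<in> S" for u v
    using supp that by blast
  note nn' = nn[of Dock Upper] nn[of Dock Lower] nn[of Bike Upper] nn[of Bike Lower]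
    nn[of Upper Dock] nn[of Upper Bike] nn[of Lower Dock] nn[of Lower Bike]
  from S[unfolded cone_tails_def] consider "S = {Dock}" | "S = {Bike}" | "S = {Dock, Bike}" | "S = -{Dock}" | "S = -{Bike}" |
    "S = -{Dock, Bike}" by blast
  then show ?thesis
    by cases (use nn' in \<open>simp_all add: up_flow_def net_def UNIV_node z max_def\<close>)
qed

lemma net_sum: "(\<Sum>i\<in>A. net (k i) u) = net (\<lambda>u v. \<Sum>i\<in>A. k i u v) u"
  by (simp add: net_def UNIV_node sum.distrib sum_subtractf)

lemma net_total: "net m Dock + net m Bike + net m Upper + net m Lower = 0"
  by (simp add: net_def UNIV_node)

lemma net_add: "net k u + net k' u = net (\<lambda>u v. k u v + k' u v) u"
  by (simp add: net_def UNIV_node)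

text \<open>
  A minimal nonempty invariant set is mapped onto itself. This yields a union of disjoint directed
  cycles without any reasoning about paths.
\<close>

lemma invariant_subset_permuted:
  fixes S :: "'a :: finite set"
  assumes "S \<noteq> {}" "s ` S \<subseteq> S"
  obtains R where "R \<subseteq> S" "R \<noteq> {}" "bij_betw s R R"
proof -
  let ?P = "\<lambda>R. R \<subseteq> S \<and> R \<noteq> {} \<and> s ` R \<subseteq> R"
  have "?P S" using assms by simp
  from ex_has_least_nat[of ?P, OF this, of card]
  obtain R where R: "?P R" and least: "\<And>R'. ?P R' \<Longrightarrow> card R \<le> card R'"
    by blast
  have "?P (s ` R)" using R by blast
  from least[OF this] R have "s ` R = R"
    by (simp add: card_seteq)
  then have "bij_betw s R R"
    by (simp add: bij_betw_def eq_card_imp_inj_on)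
  with R show thesis by (intro that) auto
qed

definition ascent :: "node \<Rightarrow> node \<Rightarrow> int" where
  "ascent u v = (if u \<in> {Dock, Bike} \<and> v \<in> {Upper, Lower} then 1 else 0)"

lemma node_forall: "(\<forall>u. P u) \<longleftrightarrow> P Dock \<and> P Bike \<and> P Upper \<and> P Lower"
  by (metis node.exhaust)

text \<open>
  With \<open>w u v = ascent u v + \<pi> u - \<pi> v\<close>, a circulation has the same total weight for \<open>w\<close> as for
  \<open>ascent\<close>, because potential differences cancel. The positive weights of the arcs that the
  flow of one index can use add up to at most \<open>4\<close> for a small potential, and the two slack pairs,
  on which \<open>ascent\<close> vanishes, have weight at most \<open>1\<close>.
\<close>

definition small_potential :: "(node \<Rightarrow> int) \<Rightarrow> bool" where
  "small_potential \<pi> \<longleftrightarrow>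
     (\<forall>S \<in> cone_tails.
       (\<Sum>u\<in>UNIV. \<Sum>v\<in>UNIV. if u \<in> S \<and> v \<notin> S then max 0 (ascent u v + \<pi> u - \<pi> v) else 0) \<le> 4) \<and>
     \<bar>\<pi> Dock - \<pi> Bike\<bar> \<le> 1 \<and> \<bar>\<pi> Upper - \<pi> Lower\<bar> \<le> 1"

text \<open>
  The potential of \<open>v\<^sub>j\<close> counts the positions before \<open>j\<close> at which the order steps from
  \<open>{Dock, Bike}\<close> to \<open>{Upper, Lower}\<close>. An arc from the former set to the latter that points forward
  passes at least one such position, so it has weight at most \<open>0\<close>; and there are at most two such
  positions, which keeps the weights of the backward arcs small. The bound \<open>4\<close> is attained, for
  example when both \<open>Upper\<close> and \<open>Lower\<close> precede \<open>Dock\<close> and \<open>Bike\<close>.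
\<close>

lemma potential_of_order:
  assumes "distinct [v1, v2, v3, v4]"
  shows "\<exists>\<pi>. small_potential \<pi> \<and> (\<forall>u v. ascent u v + \<pi> u - \<pi> v > 0 \<longrightarrow>
       (u, v) \<in> {(v4, v3), (v4, v2), (v4, v1), (v3, v2), (v3, v1), (v2, v1)})"
proof -
  define \<pi> where "\<pi> = (\<lambda>u. if u = v1 then 0 else if u = v2 then ascent v1 v2
      else if u = v3 then ascent v1 v2 + ascent v2 v3
      else ascent v1 v2 + ascent v2 v3 + ascent v3 v4)"
  have "small_potential \<pi> \<and> (\<forall>u v. ascent u v + \<pi> u - \<pi> v > 0 \<longrightarrow>
       (u, v) \<in> {(v4, v3), (v4, v2), (v4, v1), (v3, v2), (v3, v1), (v2, v1)})"
    using assms unfolding small_potential_def cone_tails_def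
    by (cases v1; cases v2; cases v3; cases v4; simp add: node_forall \<pi>_def ascent_def UNIV_node)
  then show ?thesis by (rule exI[of _ \<pi>])
qed

text \<open>
  Removing sinks one after the other yields an order in which no good arc points backward.
\<close>

lemma potential_exists:
  assumes sink: "\<And>S. S \<noteq> {} \<Longrightarrow> \<exists>u\<in>S. \<forall>v\<in>S. \<not> good u v"
  shows "\<exists>\<pi>. small_potential \<pi> \<and> (\<forall>u v. ascent u v + \<pi> u - \<pi> v > 0 \<longrightarrow> \<not> good u v)"
proof -
  have card: "card (UNIV :: node set) = 4" by (simp add: UNIV_node)
  have ne: "UNIV - set vs \<noteq> {}" if "length vs < 4" for vs :: "node list"
    using card that card_length[of vs] by (metis Diff_eq_empty_iff leD le_trans card_mono finite)
  obtain v4 where v4: "\<And>v. \<not> good v4 v" using sink[of UNIV] by blast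
  obtain v3 where v3: "v3 \<noteq> v4" "\<And>v. v \<noteq> v4 \<Longrightarrow> \<not> good v3 v"
    using sink[OF ne[of "[v4]"]] by auto
  obtain v2 where v2: "v2 \<noteq> v4" "v2 \<noteq> v3" "\<And>v. v \<noteq> v4 \<Longrightarrow> v \<noteq> v3 \<Longrightarrow> \<not> good v2 v"
    using sink[OF ne[of "[v4, v3]"]] by auto
  obtain v1 where v1: "v1 \<noteq> v4" "v1 \<noteq> v3" "v1 \<noteq> v2"
    using ne[of "[v4, v3, v2]"] by auto
  have backward: "\<not> good u v"
    if "(u, v) \<in> {(v4, v3), (v4, v2), (v4, v1), (v3, v2), (v3, v1), (v2, v1)}" for u v
    using that v1 v2 v3 v4 by auto
  have "distinct [v1, v2, v3, v4]" using v1 v2 v3 by auto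
  from potential_of_order[OF this] obtain \<pi> where "small_potential \<pi>" and
    pos: "\<forall>u v. ascent u v + \<pi> u - \<pi> v > 0 \<longrightarrow>
       (u, v) \<in> {(v4, v3), (v4, v2), (v4, v1), (v3, v2), (v3, v1), (v2, v1)}"
    by (elim exE conjE)
  moreover have "\<forall>u v. ascent u v + \<pi> u - \<pi> v > 0 \<longrightarrow> \<not> good u v"
  proof (intro allI impI)
    fix u v
    assume "ascent u v + \<pi> u - \<pi> v > 0"
    with pos have "(u, v) \<in> {(v4, v3), (v4, v2), (v4, v1), (v3, v2), (v3, v1), (v2, v1)}"
      by (elim allE impE)
    then show "\<not> good u v" by (rule backward)
  qed
  ultimately show ?thesis by (intro exI conjI)
qed

text \<open>
  Each arc \<open>(u, s u)\<close> receives \<open>lam\<close> units from one index or from the slack. Since \<open>s\<close> permutes \<open>R\<close>, every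
  node of \<open>R\<close> has one arc in and one arc out. Not all of these units can come from the slack: it
  uses each of its two pairs of nodes in one direction only and therefore contains no cycle.
\<close>

lemma circulation_of_cycle:
  fixes m :: "'n :: finite \<Rightarrow> node \<Rightarrow> node \<Rightarrow> int"
  assumes lam: "0 < lam"
    and nonneg: "\<And>i u v. 0 \<le> m i u v" "\<And>u v. 0 \<le> m0 u v"
    and slack: "\<And>u v. m0 u v = 0 \<or> m0 v u = 0"
      "\<And>u v. m0 u v \<noteq> 0 \<Longrightarrow> (u, v) \<in> {(Dock, Bike), (Bike, Dock), (Upper, Lower), (Lower, Upper)}"
    and R: "R \<noteq> {}" "bij_betw s R R"
    and good: "\<And>u. u \<in> R \<Longrightarrow> (\<exists>i. lam \<le> m i u (s u)) \<or> lam \<le> m0 u (s u)"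
  shows "\<exists>k k0. (\<forall>i u v. 0 \<le> k i u v \<and> k i u v \<le> m i u v \<and> lam dvd k i u v) \<and>
           (\<forall>u v. 0 \<le> k0 u v \<and> k0 u v \<le> m0 u v) \<and>
           (\<forall>u. (\<Sum>i\<in>UNIV. net (k i) u) + net k0 u = 0) \<and> (\<exists>i u v. k i u v \<noteq> 0)"
proof -
  define src where "src u = (if \<exists>i. lam \<le> m i u (s u) then Some (SOME i. lam \<le> m i u (s u)) else None)" for u
  have src_Some: "lam \<le> m i u (s u)" if "src u = Some i" for i u
    using that unfolding src_def by (metis option.distinct(1) option.inject someI_ex)
  have src_None: "lam \<le> m0 u (s u)" if "src u = None" "u \<in> R" for u
    using that good[of u] unfolding src_def by (auto split: if_splits)
  define k where "k i u v = (if u \<in> R \<and> v = s u \<and> src u = Some i then lam else 0)" for i u v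
  define k0 where "k0 u v = (if u \<in> R \<and> v = s u \<and> src u = None then lam else 0)" for u v
  have total: "(\<Sum>i\<in>UNIV. k i u v) + k0 u v = (if u \<in> R \<and> v = s u then lam else 0)" for u v
    by (cases "src u") (auto simp: k_def k0_def)
  have conservation: "(\<Sum>i\<in>UNIV. net (k i) u) + net k0 u = 0" for u
  proof -
    have out_flow: "(\<Sum>v\<in>UNIV. if u \<in> R \<and> v = s u then lam else 0) = (if u \<in> R then lam else 0)"
      by simp
    have "(\<Sum>v\<in>UNIV. if v \<in> R \<and> u = s v then lam else 0) = (\<Sum>v\<in>R. if u = s v then lam else 0)"
      by (simp add: sum.If_cases Collect_conj_eq)
    also have "\<dots> = (\<Sum>w\<in>R. if u = w then lam else 0)"
      by (rule sum.reindex_bij_betw[OF R(2)])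
    also have "\<dots> = (if u \<in> R then lam else 0)" by simp
    finally show ?thesis
      unfolding net_sum net_add total unfolding net_def sum_subtractf using out_flow by simp
  qed
  have "\<exists>i u v. k i u v \<noteq> 0"
  proof (rule ccontr)
    assume "\<not> (\<exists>i u v. k i u v \<noteq> 0)"
    then have "src u = None" if "u \<in> R" for u
      using that lam unfolding k_def by (metis less_irrefl option.exhaust)
    then have pos: "0 < m0 u (s u)" if "u \<in> R" for u
      using src_None that lam by (meson less_le_trans)
    obtain u where u: "u \<in> R" using R(1) by blast
    then have "s u \<in> R" using R(2) by (auto simp: bij_betw_def)
    with pos u have "0 < m0 u (s u)" "0 < m0 (s u) (s (s u))" by auto
    moreover from this slack(2)[of u "s u"] slack(2)[of "s u" "s (s u)"] have "s (s u) = u"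
      by auto
    ultimately show False using slack(1)[of u "s u"] by auto
  qed
  moreover have "0 \<le> k i u v \<and> k i u v \<le> m i u v \<and> lam dvd k i u v" for i u v
    using nonneg lam src_Some by (auto simp: k_def)
  moreover have "0 \<le> k0 u v \<and> k0 u v \<le> m0 u v" for u v
    using nonneg lam src_None by (auto simp: k0_def)
  ultimately show ?thesis using conservation by blast
qed

text \<open>
  Summation by parts; in particular the left-hand side vanishes when \<open>m\<close> is a circulation.
\<close>

lemma net_potential:
  "(\<Sum>u\<in>UNIV. \<Sum>v\<in>UNIV. m u v * (\<pi> u - \<pi> v)) = (\<Sum>u\<in>UNIV. \<pi> u * net m u)"
  by (simp add: net_def UNIV_node algebra_simps)

text \<open>
  If some nonempty set of nodes contains a good successor of each of its members, it contains a cycle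
  of good arcs. Otherwise a potential is available for which only bad arcs have positive weight,
  so that an index contributes at most \<open>4 lam\<close> and the slack at most \<open>2 lam\<close> to the total upward
  flow. This contradicts the assumed lower bound
  unless there is only one index. But there is an index that moves up and, because the slack does not
  join \<open>{Dock, Bike}\<close> to \<open>{Upper, Lower}\<close>, also one that moves down.
\<close>

lemma circulation_exists:
  fixes m :: "'n :: finite \<Rightarrow> node \<Rightarrow> node \<Rightarrow> int"
  assumes lam: "0 < lam"
    and cone: "\<And>i. cone_flow (m i)"
    and nonneg: "\<And>u v. 0 \<le> m0 u v"
    and slack: "\<And>u v. m0 u v = 0 \<or> m0 v u = 0"
      "\<And>u v. m0 u v \<noteq> 0 \<Longrightarrow> (u, v) \<in> {(Dock, Bike), (Bike, Dock), (Upper, Lower), (Lower, Upper)}"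
    and conservation: "\<And>u. (\<Sum>i\<in>UNIV. net (m i) u) + net m0 u = 0"
    and large: "5 * int CARD('n) * lam < (\<Sum>i\<in>UNIV. up_flow (m i))"
  shows "\<exists>k k0. (\<forall>i u v. 0 \<le> k i u v \<and> k i u v \<le> m i u v \<and> lam dvd k i u v) \<and>
           (\<forall>u v. 0 \<le> k0 u v \<and> k0 u v \<le> m0 u v) \<and>
           (\<forall>u. (\<Sum>i\<in>UNIV. net (k i) u) + net k0 u = 0) \<and> (\<exists>i u v. k i u v \<noteq> 0)"
proof -
  define good where "good u v \<longleftrightarrow> (\<exists>i. lam \<le> m i u v) \<or> lam \<le> m0 u v" for u v
  have nn: "0 \<le> m i u v" for i u v using cone[of i] by (auto simp: cone_flow_def)
  have slack0: "m0 u v = 0" if "(u, v) \<notin> {(Dock, Bike), (Bike, Dock), (Upper, Lower), (Lower, Upper)}" for u v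
    using slack(2) that by blast
  show ?thesis
  proof (cases "\<exists>S. S \<noteq> {} \<and> (\<forall>u\<in>S. \<exists>v\<in>S. good u v)")
    case True
    then obtain S s where "S \<noteq> {}" and s: "\<And>u. u \<in> S \<Longrightarrow> s u \<in> S \<and> good u (s u)" by metis
    then obtain R where R: "R \<subseteq> S" "R \<noteq> {}" "bij_betw s R R"
      using invariant_subset_permuted[of S s] by blast
    show ?thesis
      using R s by (intro circulation_of_cycle[OF lam nn nonneg slack R(2,3)]) (auto simp: good_def)
  next
    case False
    have sink: "\<exists>u\<in>S. \<forall>v\<in>S. \<not> good u v" if "S \<noteq> {}" for S
    proof (rule ccontr)
      assume "\<not> ?thesis"
      then have "\<forall>u\<in>S. \<exists>v\<in>S. good u v" by blast
      with that have "\<exists>S. S \<noteq> {} \<and> (\<forall>u\<in>S. \<exists>v\<in>S. good u v)" by (intro exI[of _ S] conjI)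
      with False show False by contradiction
    qed
    have "\<exists>\<pi>. small_potential \<pi> \<and> (\<forall>u v. ascent u v + \<pi> u - \<pi> v > 0 \<longrightarrow> \<not> good u v)"
      by (rule potential_exists) (rule sink)
    then obtain \<pi> where "small_potential \<pi>" and
      pos: "\<forall>u v. ascent u v + \<pi> u - \<pi> v > 0 \<longrightarrow> \<not> good u v"
      by (elim exE conjE)
    have cut: "(\<Sum>u\<in>UNIV. \<Sum>v\<in>UNIV.
        if u \<in> S \<and> v \<notin> S then max 0 (ascent u v + \<pi> u - \<pi> v) else 0) \<le> 4" if "S \<in> cone_tails" for S
      using \<open>small_potential \<pi>\<close> that unfolding small_potential_def by (elim conjE) (rule bspec)
    have gap: "\<bar>\<pi> Dock - \<pi> Bike\<bar> \<le> 1" "\<bar>\<pi> Upper - \<pi> Lower\<bar> \<le> 1"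
      using \<open>small_potential \<pi>\<close> unfolding small_potential_def by simp_all
    have bad: "\<not> good u v" if "ascent u v + \<pi> u - \<pi> v > 0" for u v
      using pos that by simp
    define w where "w u v = ascent u v + \<pi> u - \<pi> v" for u v
    have station: "(\<Sum>u\<in>UNIV. \<Sum>v\<in>UNIV. m i u v * w u v) \<le> 4 * lam" for i
    proof -
      obtain S where S: "S \<in> cone_tails"
        and supp: "\<And>u v. m i u v \<noteq> 0 \<Longrightarrow> u \<in> S \<and> v \<notin> S"
        using cone[of i] unfolding cone_flow_def by blast
      have "m i u v * w u v \<le> lam * (if u \<in> S \<and> v \<notin> S then max 0 (w u v) else 0)" for u v
      proof (cases "u \<in> S \<and> v \<notin> S")
        case True
        show ?thesis
        proof (cases "w u v > 0")
          case True
          then have "\<not> good u v" using bad[of u v] by (simp add: w_def)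
          then have "m i u v \<le> lam" by (auto simp: good_def not_le intro: less_imp_le)
          with True \<open>u \<in> S \<and> v \<notin> S\<close> show ?thesis by (simp add: mult_right_mono)
        next
          case False
          then show ?thesis using nn[of i u v] \<open>u \<in> S \<and> v \<notin> S\<close> by (simp add: mult_nonneg_nonpos)
        qed
      next
        case False
        with supp[of u v] have "m i u v = 0" by blast
        with False show ?thesis by auto
      qed
      then have "(\<Sum>u\<in>UNIV. \<Sum>v\<in>UNIV. m i u v * w u v)
          \<le> (\<Sum>u\<in>UNIV. \<Sum>v\<in>UNIV. lam * (if u \<in> S \<and> v \<notin> S then max 0 (w u v) else 0))"
        by (intro sum_mono)
      also have "\<dots> = lam * (\<Sum>u\<in>UNIV. \<Sum>v\<in>UNIV. if u \<in> S \<and> v \<notin> S then max 0 (w u v) else 0)"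
        by (simp only: sum_distrib_left)
      also have "\<dots> \<le> lam * 4"
        using cut[OF S] lam unfolding w_def by (intro mult_left_mono) auto
      finally show ?thesis by simp
    qed
    have slack_le: "m0 u v * w u v \<le> lam" if uv: "(u, v) \<in> {(Dock, Bike), (Bike, Dock), (Upper, Lower), (Lower, Upper)}" for u v
    proof (cases "w u v > 0")
      case True
      then have "\<not> good u v" using bad[of u v] by (simp add: w_def)
      then have "m0 u v < lam" by (simp add: good_def)
      moreover have "w u v = 1" using True gap uv by (auto simp: w_def ascent_def)
      ultimately show ?thesis by simp
    next
      case False
      then have "m0 u v * w u v \<le> 0" using nonneg[of u v] by (simp add: mult_nonneg_nonpos)
      then show ?thesis using lam by simp
    qed
    \<comment> \<open>only one arc of each slack pair carries flow\<close>
    have pair: "m0 u v * w u v + m0 v u * w v u \<le> lam"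
      if "(u, v) \<in> {(Dock, Bike), (Upper, Lower)}" for u v
      using slack(1)[of u v] slack_le[of u v] slack_le[of v u] that by auto
    have slack_total: "(\<Sum>u\<in>UNIV. \<Sum>v\<in>UNIV. m0 u v * w u v) \<le> 2 * lam"
      using pair[of Dock Bike] pair[of Upper Lower] by (simp add: UNIV_node slack0)
    define M where "M u v = (\<Sum>i\<in>UNIV. m i u v) + m0 u v" for u v
    have netM: "net M u = 0" for u
      using conservation[of u] unfolding net_sum net_add M_def .
    have ups: "(\<Sum>u\<in>UNIV. \<Sum>v\<in>UNIV. m u v * ascent u v) = up_flow m" for m
      by (simp add: UNIV_node up_flow_def ascent_def)
    have "(\<Sum>i\<in>UNIV. \<Sum>u\<in>UNIV. \<Sum>v\<in>UNIV. m i u v * w u v) + (\<Sum>u\<in>UNIV. \<Sum>v\<in>UNIV. m0 u v * w u v)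
       = (\<Sum>u\<in>UNIV. \<Sum>v\<in>UNIV. M u v * w u v)"
      unfolding M_def
      by (simp add: UNIV_node sum.distrib sum_distrib_right distrib_right)
    also have "\<dots> = (\<Sum>u\<in>UNIV. \<Sum>v\<in>UNIV. M u v * ascent u v) + (\<Sum>u\<in>UNIV. \<Sum>v\<in>UNIV. M u v * (\<pi> u - \<pi> v))"
      unfolding w_def by (simp add: UNIV_node algebra_simps)
    also have "\<dots> = up_flow M" unfolding net_potential ups netM by simp
    also have "\<dots> = (\<Sum>i\<in>UNIV. up_flow (m i))"
      unfolding up_flow_def M_def by (simp add: sum.distrib slack0)
    finally have "(\<Sum>i\<in>UNIV. up_flow (m i)) \<le> (\<Sum>i\<in>(UNIV :: 'n set). 4 * lam) + 2 * lam"
      using slack_total sum_mono[of UNIV "\<lambda>i. \<Sum>u\<in>UNIV. \<Sum>v\<in>UNIV. m i u v * w u v" "\<lambda>i. 4 * lam"] station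
      by (metis (no_types, lifting) add_mono)
    then have upper: "(\<Sum>i\<in>UNIV. up_flow (m i)) \<le> 4 * int CARD('n) * lam + 2 * lam" by simp
    define x where "x i = net (m i) Dock + net (m i) Bike" for i
    have "(\<Sum>i\<in>UNIV. x i) = - (net m0 Dock + net m0 Bike)"
      using conservation[of Dock] conservation[of Bike] by (simp add: x_def sum.distrib)
    also have "\<dots> = 0" by (simp add: net_def UNIV_node slack0)
    finally have x0: "(\<Sum>i\<in>UNIV. x i) = 0" .
    have "0 < 5 * int CARD('n) * lam" using lam by simp
    with large have "0 < (\<Sum>i\<in>UNIV. max 0 (x i))" unfolding x_def up_flow_eq[OF cone] by linarith
    then obtain i where i: "0 < x i"
      by (metis (no_types, lifting) max_def not_le order_refl sum_nonpos)
    obtain j where j: "x j < 0"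
      using x0 i by (metis (no_types, lifting) UNIV_I finite less_irrefl not_le sum_pos2)
    have "i \<noteq> j" using i j by auto
    then have "2 \<le> CARD('n)"
      using card_mono[of UNIV "{i, j}"] by simp
    then have "2 * lam \<le> int CARD('n) * lam"
      using lam by (intro mult_right_mono) auto
    with upper large show ?thesis by simp
  qed
qed

section \<open>The re-allocation problem\<close>

lemma DR_feasible_iff:
  fixes d b :: "int ^ 'n"
  shows "(d, b) \<in> DR_feasible dbar bbar \<gamma> l u \<longleftrightarrow>
     (\<forall>i. 0 \<le> d $ i \<and> 0 \<le> b $ i \<and> l $ i \<le> d $ i + b $ i \<and> d $ i + b $ i \<le> u $ i) \<and>
     (\<Sum>i\<in>UNIV. d $ i + b $ i) = (\<Sum>i\<in>UNIV. dbar $ i + bbar $ i) \<and>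
     (\<Sum>i\<in>UNIV. b $ i) \<le> (\<Sum>i\<in>UNIV. bbar $ i) \<and>
     (\<Sum>i\<in>UNIV. excess (dbar $ i + bbar $ i) (d $ i + b $ i)) \<le> \<gamma>"
proof -
  have "\<bar>y\<bar> = 2 * max y 0 - y" for y :: int by auto
  then have "l1_norm ((d + b) - (dbar + bbar))
      = 2 * (\<Sum>i\<in>UNIV. excess (dbar $ i + bbar $ i) (d $ i + b $ i))
        - ((\<Sum>i\<in>UNIV. d $ i + b $ i) - (\<Sum>i\<in>UNIV. dbar $ i + bbar $ i))"
    by (simp add: l1_norm_def excess_def sum_subtractf sum_distrib_left)
  then show ?thesis
    by (auto simp: DR_feasible_def vec_sum_def less_eq_vec_def sum.distrib)
qed

lemma finite_DR_feasible:
  fixes dbar bbar l u :: "int ^ 'n"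
  shows "finite (DR_feasible dbar bbar \<gamma> l u)"
proof -
  define K where "K = (\<Sum>i\<in>UNIV. dbar $ i + bbar $ i)"
  let ?V = "vec_lambda ` (UNIV \<rightarrow>\<^sub>E {0..K}) :: (int ^ 'n) set"
  have "d \<in> ?V \<and> b \<in> ?V" if "(d, b) \<in> DR_feasible dbar bbar \<gamma> l u" for d b
  proof -
    have nn: "0 \<le> d $ i" "0 \<le> b $ i" for i
      using that unfolding DR_feasible_iff by auto
    have K: "(\<Sum>i\<in>UNIV. d $ i + b $ i) = K"
      using that unfolding DR_feasible_iff K_def by blast
    have le: "d $ i + b $ i \<le> K" for i
      unfolding K[symmetric] using nn by (intro member_le_sum) auto
    have "d $ i \<in> {0..K}" "b $ i \<in> {0..K}" for i
      using nn[of i] le[of i] by simp_all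
    then have "vec_nth d \<in> UNIV \<rightarrow>\<^sub>E {0..K}" "vec_nth b \<in> UNIV \<rightarrow>\<^sub>E {0..K}" by auto
    then show ?thesis by (metis image_eqI vec_nth_inverse)
  qed
  then have "DR_feasible dbar bbar \<gamma> l u \<subseteq> ?V \<times> ?V" by auto
  moreover have "finite (?V \<times> ?V)" by (intro finite_cartesian_product finite_imageI finite_PiE) auto
  ultimately show ?thesis by (rule finite_subset)
qed

text \<open>
  A partial step from \<open>(d, b)\<close> towards \<open>(d', b')\<close> keeps every constrained quantity between its
  values at the two points, except for the total excess, which stays below such a value. The reverse
  step from \<open>(d', b')\<close> is the same statement with the points interchanged and \<open>p\<close>, \<open>q\<close>, \<open>t\<close> negated.
\<close>

lemma feasible_step_towards:
  fixes d b d' b' p q :: "int ^ 'n"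
  assumes y: "(d, b) \<in> DR_feasible dbar bbar \<gamma> l u"
    and z: "(d', b') \<in> DR_feasible dbar bbar \<gamma> l u"
    and p: "\<And>i. between_zero (p $ i) (d' $ i - d $ i)"
    and q: "\<And>i. between_zero (q $ i) (b' $ i - b $ i)"
    and pq: "\<And>i. between_zero (p $ i + q $ i) (d' $ i + b' $ i - (d $ i + b $ i))"
    and ex: "\<And>i. excess (dbar $ i + bbar $ i) (d $ i + b $ i + (p $ i + q $ i))
       \<le> excess (dbar $ i + bbar $ i) (d $ i + b $ i) + t i"
    and sum0: "(\<Sum>i\<in>UNIV. p $ i + q $ i) = 0"
    and sum_q: "between_zero (\<Sum>i\<in>UNIV. q $ i) ((\<Sum>i\<in>UNIV. b' $ i) - (\<Sum>i\<in>UNIV. b $ i))"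
    and sum_t: "between_zero (\<Sum>i\<in>UNIV. t i)
       ((\<Sum>i\<in>UNIV. excess (dbar $ i + bbar $ i) (d' $ i + b' $ i))
        - (\<Sum>i\<in>UNIV. excess (dbar $ i + bbar $ i) (d $ i + b $ i)))"
  shows "(d + p, b + q) \<in> DR_feasible dbar bbar \<gamma> l u"
proof -
  note y = y[unfolded DR_feasible_iff] and z = z[unfolded DR_feasible_iff]
  have between: "min x x' \<le> x + v \<and> x + v \<le> max x x'" if "between_zero v (x' - x)" for v x x'
    using that unfolding between_zero_def by linarith
  have "0 \<le> d $ i + p $ i" "0 \<le> b $ i + q $ i"
    "l $ i \<le> d $ i + b $ i + (p $ i + q $ i)" "d $ i + b $ i + (p $ i + q $ i) \<le> u $ i" for i
    using between[OF p[of i]] between[OF q[of i]] between[OF pq[of i]] y z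
    by (smt (verit))+
  moreover have "(\<Sum>i\<in>UNIV. d $ i + b $ i + (p $ i + q $ i)) = (\<Sum>i\<in>UNIV. dbar $ i + bbar $ i)"
    using y sum0 by (simp only: sum.distrib[of "\<lambda>i. d $ i + b $ i"])
  moreover have "(\<Sum>i\<in>UNIV. b $ i) + (\<Sum>i\<in>UNIV. q $ i) \<le> (\<Sum>i\<in>UNIV. bbar $ i)"
    using y z between[OF sum_q] by linarith
  moreover have "(\<Sum>i\<in>UNIV. excess (dbar $ i + bbar $ i) (d $ i + b $ i + (p $ i + q $ i))) \<le> \<gamma>"
  proof -
    have "(\<Sum>i\<in>UNIV. excess (dbar $ i + bbar $ i) (d $ i + b $ i + (p $ i + q $ i)))
        \<le> (\<Sum>i\<in>UNIV. excess (dbar $ i + bbar $ i) (d $ i + b $ i) + t i)"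
      by (intro sum_mono ex)
    also have "\<dots> = (\<Sum>i\<in>UNIV. excess (dbar $ i + bbar $ i) (d $ i + b $ i)) + (\<Sum>i\<in>UNIV. t i)"
      by (rule sum.distrib)
    also have "\<dots> \<le> \<gamma>" using y z between[OF sum_t] by linarith
    finally show ?thesis .
  qed
  moreover have e: "d $ i + p $ i + (b $ i + q $ i) = d $ i + b $ i + (p $ i + q $ i)" for i by simp
  ultimately show ?thesis
    unfolding DR_feasible_iff vector_add_component e by (simp add: sum.distrib)
qed

definition distance :: "(int ^ 'n) \<times> (int ^ 'n) \<Rightarrow> (int ^ 'n) \<times> (int ^ 'n) \<Rightarrow> int" where
  "distance = (\<lambda>(d, b) (d', b'). l1_norm (d' - d) + l1_norm (b' - b))"

text \<open>
  The flows of all indices and the slack \<open>m0\<close> form a circulation: \<open>m0\<close> carries the change \<open>\<beta>\<close> of the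
  total of \<open>b\<close> from \<open>Dock\<close> back to \<open>Bike\<close> and the change \<open>\<sigma>\<close> of the total excess from \<open>Upper\<close> back to
  \<open>Lower\<close>. A smaller circulation in multiples of \<open>lam\<close> then moves the total of \<open>b\<close> by an amount
  between \<open>0\<close> and \<open>\<beta>\<close>, and the total excess by at most an amount between \<open>0\<close> and \<open>\<sigma>\<close>, so that both inequality constraints survive at both points, whether or not they
  are tight.
\<close>

lemma exchange_closer:
  fixes d b d' b' :: "int ^ 'n"
  assumes multimodular: "\<And>i. multimodular (c i)"
    and lam: "0 < lam"
    and y: "(d, b) \<in> DR_feasible dbar bbar \<gamma> l u"
    and z: "(d', b') \<in> DR_feasible dbar bbar \<gamma> l u"
    and far: "10 * int CARD('n) * lam < l1_norm ((d' + b') - (d + b))"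
  shows "\<exists>p q. (\<forall>i. lam dvd p $ i \<and> lam dvd q $ i) \<and>
     (d + p, b + q) \<in> DR_feasible dbar bbar \<gamma> l u \<and>
     (d' - p, b' - q) \<in> DR_feasible dbar bbar \<gamma> l u \<and>
     DR_cost c (d + p, b + q) + DR_cost c (d' - p, b' - q) \<le> DR_cost c (d, b) + DR_cost c (d', b') \<and>
     distance (d, b) (d' - p, b' - q) < distance (d, b) (d', b')"
proof -
  define a where "a i = dbar $ i + bbar $ i" for i
  define x where "x i = d' $ i + b' $ i - (d $ i + b $ i)" for i
  note yF = y[unfolded DR_feasible_iff] and zF = z[unfolded DR_feasible_iff]
  have "\<exists>m. exchange_flow (c i) (a i) (d $ i) (b $ i) (d' $ i) (b' $ i) m" for i
    using yF zF multimodular by (intro exchange_flow_exists) auto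
  then obtain m where m: "\<And>i. exchange_flow (c i) (a i) (d $ i) (b $ i) (d' $ i) (b' $ i) (m i)"
    by metis
  have cone: "cone_flow (m i)" for i using m[of i] by (simp add: exchange_flow_def)
  have net_m: "net (m i) Dock = d' $ i - d $ i" "net (m i) Bike = b' $ i - b $ i"
    "net (m i) Upper = excess (a i) (d $ i + b $ i) - excess (a i) (d' $ i + b' $ i)" for i
    using m[of i] by (simp_all add: exchange_flow_def)
  define \<beta> where "\<beta> = (\<Sum>i\<in>UNIV. b' $ i) - (\<Sum>i\<in>UNIV. b $ i)"
  define \<sigma> where "\<sigma> = (\<Sum>i\<in>UNIV. excess (a i) (d' $ i + b' $ i)) - (\<Sum>i\<in>UNIV. excess (a i) (d $ i + b $ i))"
  define m0 where "m0 = (\<lambda>v w. case (v, w) of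
      (Dock, Bike) \<Rightarrow> max \<beta> 0 | (Bike, Dock) \<Rightarrow> max (- \<beta>) 0
    | (Upper, Lower) \<Rightarrow> max \<sigma> 0 | (Lower, Upper) \<Rightarrow> max (- \<sigma>) 0 | _ \<Rightarrow> 0)"
  have net_m0: "net m0 Dock = \<beta>" "net m0 Bike = - \<beta>" "net m0 Upper = \<sigma>" "net m0 Lower = - \<sigma>"
    by (simp_all add: net_def UNIV_node m0_def)
  have x0: "(\<Sum>i\<in>UNIV. x i) = 0"
    using yF zF by (simp add: x_def sum_subtractf)
  have bikes: "(\<Sum>i\<in>UNIV. net (m i) Bike) = \<beta>"
    by (simp add: net_m \<beta>_def sum_subtractf)
  have docks: "(\<Sum>i\<in>UNIV. net (m i) Dock) = - \<beta>"
  proof -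
    have "(\<Sum>i\<in>UNIV. net (m i) Dock) + (\<Sum>i\<in>UNIV. net (m i) Bike) = (\<Sum>i\<in>UNIV. x i)"
      by (simp add: net_m x_def sum.distrib[symmetric] algebra_simps)
    with bikes x0 show ?thesis by simp
  qed
  have upper: "(\<Sum>i\<in>UNIV. net (m i) Upper) = - \<sigma>"
    by (simp add: net_m \<sigma>_def sum_subtractf)
  have lower: "(\<Sum>i\<in>UNIV. net (m i) Lower) = \<sigma>"
    using docks bikes upper net_total[of "\<lambda>u v. \<Sum>i\<in>UNIV. m i u v"] unfolding net_sum by linarith
  have conservation: "(\<Sum>i\<in>UNIV. net (m i) v) + net m0 v = 0" for v
    by (cases v) (simp_all add: bikes docks upper lower net_m0)
  have "2 * (\<Sum>i\<in>UNIV. up_flow (m i)) = l1_norm ((d' + b') - (d + b))"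
  proof -
    have x_net: "net (m i) Dock + net (m i) Bike = x i" for i by (simp add: net_m x_def)
    have "2 * max 0 y = \<bar>y\<bar> + y" for y :: int by auto
    then have "2 * (\<Sum>i\<in>UNIV. up_flow (m i)) = (\<Sum>i\<in>UNIV. \<bar>x i\<bar>) + (\<Sum>i\<in>UNIV. x i)"
      by (simp add: up_flow_eq[OF cone] x_net sum_distrib_left sum.distrib)
    then have "2 * (\<Sum>i\<in>UNIV. up_flow (m i)) = (\<Sum>i\<in>UNIV. \<bar>x i\<bar>)" unfolding x0 by simp
    then show ?thesis by (simp add: l1_norm_def x_def)
  qed
  with far have "5 * int CARD('n) * lam < (\<Sum>i\<in>UNIV. up_flow (m i))" by simp
  moreover have "0 \<le> m0 v w" "m0 v w = 0 \<or> m0 w v = 0"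
    "m0 v w \<noteq> 0 \<Longrightarrow> (v, w) \<in> {(Dock, Bike), (Bike, Dock), (Upper, Lower), (Lower, Upper)}" for v w
    by (cases v; cases w; simp add: m0_def; linarith)+
  ultimately have "\<exists>k k0. (\<forall>i v w. 0 \<le> k i v w \<and> k i v w \<le> m i v w \<and> lam dvd k i v w) \<and>
      (\<forall>v w. 0 \<le> k0 v w \<and> k0 v w \<le> m0 v w) \<and>
      (\<forall>v. (\<Sum>i\<in>UNIV. net (k i) v) + net k0 v = 0) \<and> (\<exists>i v w. k i v w \<noteq> 0)"
    by (intro circulation_exists[OF lam cone _ _ _ conservation])
  then obtain k k0 j v w where
    k: "\<forall>i v w. 0 \<le> k i v w \<and> k i v w \<le> m i v w \<and> lam dvd k i v w" and
    k0: "\<forall>v w. 0 \<le> k0 v w \<and> k0 v w \<le> m0 v w" and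
    k_cons: "\<forall>v. (\<Sum>i\<in>UNIV. net (k i) v) + net k0 v = 0" and
    k_nz: "k j v w \<noteq> 0"
    by (elim exE conjE)
  note k0 = k0[rule_format] and k_cons = k_cons[rule_format]
  have step: "exchange_step (c i) (a i) (d $ i) (b $ i) (d' $ i) (b' $ i) (k i)" for i
  proof -
    have "(\<forall>v w. 0 \<le> k i v w \<and> k i v w \<le> m i v w) \<longrightarrow>
        exchange_step (c i) (a i) (d $ i) (b $ i) (d' $ i) (b' $ i) (k i)"
      using m[of i] unfolding exchange_flow_def by (elim conjE allE[of _ "k i"])
    with k show ?thesis by simp
  qed
  define p :: "int ^ 'n" where "p = (\<chi> i. net (k i) Dock)"
  define q :: "int ^ 'n" where "q = (\<chi> i. net (k i) Bike)"
  define t where "t i = - net (k i) Upper" for i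
  have pq_net: "net (k i) Dock = p $ i" "net (k i) Bike = q $ i" "net (k i) Upper = - t i" for i
    by (simp_all add: p_def q_def t_def)
  note step' = step[unfolded exchange_step_def pq_net]
  have k0_zero: "k0 v w = 0" if "m0 v w = 0" for v w
    using k0[of v w] that by simp
  have net_k0: "net k0 Dock = k0 Dock Bike - k0 Bike Dock" "net k0 Bike = k0 Bike Dock - k0 Dock Bike"
    "net k0 Upper = k0 Upper Lower - k0 Lower Upper"
    by (simp_all add: net_def UNIV_node m0_def k0_zero)
  have sums: "(\<Sum>i\<in>UNIV. p $ i) = - net k0 Dock" "(\<Sum>i\<in>UNIV. q $ i) = - net k0 Bike"
    "(\<Sum>i\<in>UNIV. t i) = net k0 Upper"
    using k_cons[of Dock] k_cons[of Bike] k_cons[of Upper] by (simp_all add: pq_net sum_negf)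
  have sum0: "(\<Sum>i\<in>UNIV. p $ i + q $ i) = 0"
    by (simp add: sum.distrib sums net_k0)
  have sum_q: "between_zero (\<Sum>i\<in>UNIV. q $ i) \<beta>"
    using k0[of Dock Bike] k0[of Bike Dock] unfolding sums net_k0 between_zero_def
    by (simp add: m0_def) linarith
  have sum_t: "between_zero (\<Sum>i\<in>UNIV. t i) \<sigma>"
    using k0[of Upper Lower] k0[of Lower Upper] unfolding sums net_k0 between_zero_def
    by (simp add: m0_def) linarith
  have neg: "between_zero (- v) w'" if "between_zero v w" "w' = - w" for v w w'
    using that unfolding between_zero_def by linarith
  have "lam dvd net (k i) v" for i v
    using k unfolding net_def by (intro dvd_sum dvd_diff) auto
  then have "\<forall>i. lam dvd p $ i \<and> lam dvd q $ i" by (simp add: p_def q_def)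
  moreover have "(d + p, b + q) \<in> DR_feasible dbar bbar \<gamma> l u"
    using step' sum0 sum_q sum_t unfolding \<beta>_def \<sigma>_def a_def
    by (intro feasible_step_towards[OF y z, where t = t]) auto
  moreover have "(d' + (- p), b' + (- q)) \<in> DR_feasible dbar bbar \<gamma> l u"
  proof (rule feasible_step_towards[OF z y, where t = "\<lambda>i. - t i"])
    fix i
    show "between_zero ((- p) $ i) (d $ i - d' $ i)" "between_zero ((- q) $ i) (b $ i - b' $ i)"
      using step'[of i] by (auto intro: neg)
    have "between_zero (- (p $ i + q $ i)) (d $ i + b $ i - (d' $ i + b' $ i))"
      using step'[of i] by (intro neg[of "p $ i + q $ i"]) auto
    then show "between_zero ((- p) $ i + (- q) $ i) (d $ i + b $ i - (d' $ i + b' $ i))" by simp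
    have e: "d' $ i + b' $ i + ((- p) $ i + (- q) $ i) = d' $ i + b' $ i - (p $ i + q $ i)" by simp
    show "excess (dbar $ i + bbar $ i) (d' $ i + b' $ i + ((- p) $ i + (- q) $ i))
       \<le> excess (dbar $ i + bbar $ i) (d' $ i + b' $ i) + - t i"
      using step'[of i] unfolding e a_def by linarith
  next
    show "(\<Sum>i\<in>UNIV. (- p) $ i + (- q) $ i) = 0"
      using sum0 by (simp add: sum_subtractf sum_negf sum.distrib)
    show "between_zero (\<Sum>i\<in>UNIV. (- q) $ i) ((\<Sum>i\<in>UNIV. b $ i) - (\<Sum>i\<in>UNIV. b' $ i))"
      using neg[OF sum_q] by (simp add: sum_negf \<beta>_def)
    show "between_zero (\<Sum>i\<in>UNIV. - t i)
       ((\<Sum>i\<in>UNIV. excess (dbar $ i + bbar $ i) (d $ i + b $ i))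
        - (\<Sum>i\<in>UNIV. excess (dbar $ i + bbar $ i) (d' $ i + b' $ i)))"
      using neg[OF sum_t] by (simp add: sum_negf \<sigma>_def a_def)
  qed
  then have "(d' - p, b' - q) \<in> DR_feasible dbar bbar \<gamma> l u" by simp
  moreover have "DR_cost c (d + p, b + q) + DR_cost c (d' - p, b' - q)
      \<le> DR_cost c (d, b) + DR_cost c (d', b')"
    unfolding DR_cost_def using step' by (simp add: sum.distrib[symmetric] sum_mono)
  moreover have "distance (d, b) (d' - p, b' - q) < distance (d, b) (d', b')"
  proof -
    have abs_le: "\<bar>w - v\<bar> \<le> \<bar>w\<bar>" if "between_zero v w" for v w
      using that unfolding between_zero_def by linarith
    have abs_less: "\<bar>w - v\<bar> < \<bar>w\<bar>" if "between_zero v w" "v \<noteq> 0" for v w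
      using that unfolding between_zero_def by linarith
    have assoc: "d' $ i - p $ i - d $ i = d' $ i - d $ i - p $ i"
      "b' $ i - q $ i - b $ i = b' $ i - b $ i - q $ i" for i by auto
    have j: "p $ j \<noteq> 0 \<or> q $ j \<noteq> 0"
      using k_nz step'[of j] by blast
    have p: "between_zero (p $ i) (d' $ i - d $ i)" and q: "between_zero (q $ i) (b' $ i - b $ i)" for i
      using step'[of i] by simp_all
    have le: "\<bar>d' $ i - d $ i - p $ i\<bar> + \<bar>b' $ i - b $ i - q $ i\<bar>
        \<le> \<bar>d' $ i - d $ i\<bar> + \<bar>b' $ i - b $ i\<bar>" for i
      using abs_le[OF p[of i]] abs_le[OF q[of i]] by linarith
    have less: "\<bar>d' $ j - d $ j - p $ j\<bar> + \<bar>b' $ j - b $ j - q $ j\<bar>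
        < \<bar>d' $ j - d $ j\<bar> + \<bar>b' $ j - b $ j\<bar>"
      using j abs_le[OF p[of j]] abs_le[OF q[of j]] abs_less[OF p[of j]] abs_less[OF q[of j]]
      by linarith
    have "(\<Sum>i\<in>UNIV. \<bar>d' $ i - d $ i - p $ i\<bar> + \<bar>b' $ i - b $ i - q $ i\<bar>)
        < (\<Sum>i\<in>UNIV. \<bar>d' $ i - d $ i\<bar> + \<bar>b' $ i - b $ i\<bar>)"
      by (rule sum_strict_mono_ex1) (use le less in auto)
    then show ?thesis
      by (simp add: distance_def l1_norm_def assoc sum.distrib)
  qed
  ultimately show ?thesis by blast
qed

theorem theorem2:
  fixes dbar bbar l u d0 b0 d b :: "int ^ 'n"
    and \<gamma> lam :: int
    and c :: "'n \<Rightarrow> int \<Rightarrow> int \<Rightarrow> real"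
  assumes "0 \<le> dbar" and "0 \<le> bbar"
    and "\<gamma> > 0"
    and "\<And>i. multimodular (c i)"
    and "lam > 0"
    and "(d0, b0) \<in> DR_feasible dbar bbar \<gamma> l u"
    and "scaled_DR_optimal dbar bbar \<gamma> l u c (d0, b0) lam (d, b)"
  shows "\<exists>dstar bstar. DR_optimal dbar bbar \<gamma> l u c (dstar, bstar) \<and>
           l1_norm ((dstar + bstar) - (d + b)) \<le> 10 * int CARD('n) * lam"
proof -
  let ?F = "DR_feasible dbar bbar \<gamma> l u"
  let ?opt = "DR_optimal dbar bbar \<gamma> l u c"
  have y: "(d, b) \<in> ?F" and cong: "\<And>i. [d $ i = d0 $ i] (mod lam) \<and> [b $ i = b0 $ i] (mod lam)"
    and y_min: "\<And>y'. y' \<in> scaled_DR_feasible dbar bbar \<gamma> l u (d0, b0) lam \<Longrightarrow> DR_cost c (d, b) \<le> DR_cost c y'"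
    using assms(7)
    by (auto simp: scaled_DR_optimal_def scaled_DR_feasible_def is_arg_min_linorder)
  have opt_iff: "?opt z \<longleftrightarrow> z \<in> ?F \<and> (\<forall>z'\<in>?F. DR_cost c z \<le> DR_cost c z')" for z
    by (auto simp: DR_optimal_def is_arg_min_linorder)
  obtain z0 where z0: "?opt z0"
    using ex_is_arg_min_if_finite[OF finite_DR_feasible, of dbar bbar \<gamma> l u "DR_cost c"] y
    unfolding DR_optimal_def by blast
  obtain z where z: "?opt z" and
    closest: "\<And>z'. ?opt z' \<Longrightarrow> nat (distance (d, b) z) \<le> nat (distance (d, b) z')"
    using ex_has_least_nat[of ?opt, OF z0, of "\<lambda>z. nat (distance (d, b) z)"] by blast
  obtain d' b' where z_eq: "z = (d', b')" by (cases z)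
  have "l1_norm ((d' + b') - (d + b)) \<le> 10 * int CARD('n) * lam"
  proof (rule ccontr)
    assume "\<not> ?thesis"
    then have far: "10 * int CARD('n) * lam < l1_norm ((d' + b') - (d + b))" by simp
    have zF: "(d', b') \<in> ?F" using z unfolding opt_iff z_eq by blast
    from exchange_closer[of c, OF assms(4,5) y zF far] obtain p q where
      dvd: "\<forall>i. lam dvd p $ i \<and> lam dvd q $ i" and
      y': "(d + p, b + q) \<in> ?F" and z': "(d' - p, b' - q) \<in> ?F" and
      cost: "DR_cost c (d + p, b + q) + DR_cost c (d' - p, b' - q) \<le> DR_cost c (d, b) + DR_cost c (d', b')" and
      closer: "distance (d, b) (d' - p, b' - q) < distance (d, b) (d', b')" by (elim exE conjE)
    have "[p $ i = 0] (mod lam)" "[q $ i = 0] (mod lam)" for i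
      using dvd by (simp_all add: cong_0_iff)
    then have "[d $ i + p $ i = d0 $ i + 0] (mod lam)" "[b $ i + q $ i = b0 $ i + 0] (mod lam)" for i
      using cong by (blast intro: cong_add)+
    with y' have "(d + p, b + q) \<in> scaled_DR_feasible dbar bbar \<gamma> l u (d0, b0) lam"
      by (simp add: scaled_DR_feasible_def)
    from y_min[OF this] cost have "DR_cost c (d' - p, b' - q) \<le> DR_cost c (d', b')" by linarith
    with z z' have "?opt (d' - p, b' - q)"
      unfolding opt_iff z_eq by (meson order_trans)
    from closest[OF this] closer show False
      by (simp add: z_eq distance_def l1_norm_def nat_le_eq_zle sum_nonneg add_nonneg_nonneg)
  qed
  with z z_eq show ?thesis by blast
qed

end
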